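(* For any $x$ and all integers $n \geq 0$, $$\binom{x+n}{n} = \sum_{i=1}^{n} \binom{x+n}{i}\binom{x+n-i}{n-i}\binom{n}{i}\binom{2n-1}{i}^{-1}(-1)^{i+1} + [n=0].$$
   Context: $x$ is an indeterminate (or an arbitrary number), $\binom{y}{k} = y(y-1)\cdots(y-k+1)/k!$ for integers $k\ge 0$, and $[n=0]$ equals $1$ if $n=0$ and $0$ otherwise. The sum is empty when $n=0$. *)

theory Defs
  imports Complex_Main
begin

end

theory Submission
  imports Defs
begin

text \<open>
  Write \<open>C(y, k)\<close> for \<^term>\<open>y gchoose k\<close>. Trinomial revision gives
  \<open>C(x+n, i) C(x+n-i, n-i) = C(x+n, n) C(n, i)\<close>, so the factor \<open>C(x+n, n)\<close> comes out of
  the sum and \<open>x\<close> disappears: for \<open>n \<ge> 1\<close> the claim is that the sum of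
  \<open>(-1)^i C(n, i)^2 / C(2n-1, i)\<close> over \<open>0 \<le> i \<le> n\<close> vanishes, its term at \<open>i = 0\<close> being 1.

  The quotient \<open>C(n, i) / C(2n-1, i)\<close> is a polynomial in \<open>i\<close> in disguise: choosing disjoint
  sets of sizes \<open>i\<close> and \<open>n-1\<close> among \<open>2n-1\<close> points in either order
  (lemma \<open>gbinomial_disjoint_choices\<close>) shows that it equals
  \<open>C(2n-1-i, n-1) / C(2n-1, n-1)\<close>. The numerator has degree \<open>n-1\<close> in \<open>i\<close>, and the alternating
  sum against \<open>C(n, i)\<close> is an \<open>n\<close>-th finite difference, which kills polynomials of degree
  below \<open>n\<close> (lemma \<open>alternating_sum_gbinomial_eq_0\<close>).
\<close>

text \<open>
  Pascal's rule, read as the statement that the \<open>(n+1)\<close>-st finite difference is the \<open>n\<close>-th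
  difference of the first one.
\<close>
lemma alternating_binomial_sum_Suc:
  fixes f :: "nat \<Rightarrow> 'a::comm_ring_1"
  shows "(\<Sum>i\<le>Suc n. (-1) ^ i * of_nat (Suc n choose i) * f i) =
         (\<Sum>i\<le>n. (-1) ^ i * of_nat (n choose i) * (f i - f (Suc i)))"
proof -
  have "(\<Sum>i\<le>n. (-1) ^ i * of_nat (n choose i) * f i) =
        (\<Sum>i\<le>Suc n. (-1) ^ i * of_nat (n choose i) * f i)"
    by (simp add: binomial_eq_0)
  also have "\<dots> = f 0 + (\<Sum>i\<le>n. (-1) ^ Suc i * of_nat (n choose Suc i) * f (Suc i))"
    by (subst sum.atMost_Suc_shift) simp
  finally have unshifted: "(\<Sum>i\<le>n. (-1) ^ i * of_nat (n choose i) * f i) = \<dots>" .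
  have "(\<Sum>i\<le>Suc n. (-1) ^ i * of_nat (Suc n choose i) * f i) =
        f 0 + (\<Sum>i\<le>n. (-1) ^ Suc i * of_nat (n choose Suc i) * f (Suc i)
                      - (-1) ^ i * of_nat (n choose i) * f (Suc i))"
    by (subst sum.atMost_Suc_shift) (auto simp: algebra_simps intro!: sum.cong)
  also have "\<dots> = (\<Sum>i\<le>n. (-1) ^ i * of_nat (n choose i) * f i)
                  - (\<Sum>i\<le>n. (-1) ^ i * of_nat (n choose i) * f (Suc i))"
    unfolding unshifted by (simp only: sum_subtractf add_diff_eq)
  finally show ?thesis
    by (simp only: sum_subtractf right_diff_distrib)
qed

text \<open>
  As a function of \<open>i\<close>, \<^term>\<open>(a - of_nat i) gchoose k\<close> is a polynomial of degree \<open>k\<close>; each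
  difference lowers the degree by one, since \<open>C(a, k+1) - C(a-1, k+1) = C(a-1, k)\<close>.
\<close>
lemma alternating_sum_gbinomial_eq_0:
  fixes a :: "'a::field_char_0"
  assumes "k < n"
  shows "(\<Sum>i\<le>n. (-1) ^ i * of_nat (n choose i) * ((a - of_nat i) gchoose k)) = 0"
  using assms
proof (induction n arbitrary: a k)
  case 0
  then show ?case by simp
next
  case (Suc n)
  show ?case
  proof (cases k)
    case 0
    then show ?thesis
      by (simp only: alternating_binomial_sum_Suc) simp
  next
    case (Suc j)
    have pascal: "((a - of_nat i) gchoose Suc j) - ((a - of_nat (Suc i)) gchoose Suc j) =
        ((a - 1 - of_nat i) gchoose j)" for i
      using gbinomial_Suc_Suc[of "a - 1 - of_nat i" j] by (simp add: algebra_simps)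
    have "j < n" using Suc Suc.prems by simp
    then show ?thesis
      unfolding Suc alternating_binomial_sum_Suc pascal by (rule Suc.IH)
  qed
qed

lemma gbinomial_disjoint_choices:
  fixes a :: "'a::field_char_0"
  shows "(a gchoose i) * ((a - of_nat i) gchoose m) = (a gchoose m) * ((a - of_nat m) gchoose i)"
proof -
  have "(a gchoose i) * ((a - of_nat i) gchoose m) =
        (a gchoose (i + m)) * (of_nat (i + m) gchoose i)"
    using gbinomial_trinomial_revision[of i "i + m" a] by simp
  also have "(of_nat (i + m) gchoose i :: 'a) = (of_nat (i + m) gchoose m)"
    using binomial_symmetric[of i "i + m"] by (simp only: binomial_gbinomial[symmetric]) simp
  also have "(a gchoose (i + m)) * \<dots> = (a gchoose m) * ((a - of_nat m) gchoose i)"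
    using gbinomial_trinomial_revision[of m "i + m" a] by simp
  finally show ?thesis .
qed

lemma alternating_sum_binomial_quotient:
  assumes "n > 0"
  shows "(\<Sum>i\<le>n. (-1) ^ i * of_nat (n choose i) *
           ((of_nat n gchoose i) * inverse ((2 * of_nat n - 1) gchoose i))) = (0::'a::field_char_0)"
proof -
  define N :: 'a where "N = 2 * of_nat n - 1"
  have N_nat: "N = of_nat (2 * n - 1)"
    using assms by (simp add: N_def of_nat_diff)
  have nonzero: "N gchoose i \<noteq> 0" if "i \<le> n" for i
    using that assms unfolding N_nat binomial_gbinomial[symmetric] by simp
  have quotient: "(of_nat n gchoose i) * inverse (N gchoose i) =
      ((N - of_nat i) gchoose (n - 1)) * inverse (N gchoose (n - 1))" if "i \<le> n" for i
  proof -
    have "N - of_nat (n - 1) = of_nat n"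
      using assms by (simp add: N_def of_nat_diff)
    then show ?thesis
      using gbinomial_disjoint_choices[of N i "n - 1"] nonzero[OF that] nonzero[of "n - 1"]
      by (simp add: field_simps)
  qed
  have "(\<Sum>i\<le>n. (-1) ^ i * of_nat (n choose i) *
           ((of_nat n gchoose i) * inverse (N gchoose i))) =
        (\<Sum>i\<le>n. (-1) ^ i * of_nat (n choose i) * ((N - of_nat i) gchoose (n - 1)))
          * inverse (N gchoose (n - 1))"
    unfolding sum_distrib_right by (rule sum.cong) (simp_all add: quotient mult.assoc)
  also have "\<dots> = 0"
    using assms by (simp add: alternating_sum_gbinomial_eq_0)
  finally show ?thesis
    unfolding N_def .
qed

theorem mainTheorem3:
  fixes x :: "'a::field_char_0" and n :: nat
  shows "(x + of_nat n) gchoose n =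
    (\<Sum>i=1..n. ((x + of_nat n) gchoose i) * ((x + of_nat n - of_nat i) gchoose (n - i))
        * (of_nat n gchoose i) * inverse ((2 * of_nat n - 1) gchoose i) * (-1) ^ (i + 1))
    + (if n = 0 then 1 else 0)"
proof (cases "n = 0")
  case True
  then show ?thesis by simp
next
  case False
  define y where "y = x + of_nat n"
  define t :: "nat \<Rightarrow> 'a" where "t i = (-1) ^ i * of_nat (n choose i) *
    ((of_nat n gchoose i) * inverse ((2 * of_nat n - 1) gchoose i))" for i
  have "(\<Sum>i\<le>n. t i) = 0"
    unfolding t_def using False by (intro alternating_sum_binomial_quotient) simp
  moreover have "(\<Sum>i\<le>n. t i) = t 0 + (\<Sum>i=1..n. t i)"
    by (simp add: atMost_atLeast0 sum.atLeast_Suc_atMost)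
  moreover have "t 0 = 1"
    by (simp add: t_def)
  ultimately have tail: "(\<Sum>i=1..n. t i) = -1"
    by (simp add: add_eq_0_iff)
  have "(\<Sum>i=1..n. (y gchoose i) * ((y - of_nat i) gchoose (n - i))
        * (of_nat n gchoose i) * inverse ((2 * of_nat n - 1) gchoose i) * (-1) ^ (i + 1)) =
      (\<Sum>i=1..n. - (y gchoose n) * t i)"
  proof (rule sum.cong)
    fix i assume "i \<in> {1..n}"
    then have "(y gchoose i) * ((y - of_nat i) gchoose (n - i)) =
        (y gchoose n) * of_nat (n choose i)"
      using gbinomial_trinomial_revision[of i n y] by (simp add: binomial_gbinomial)
    then show "(y gchoose i) * ((y - of_nat i) gchoose (n - i))
        * (of_nat n gchoose i) * inverse ((2 * of_nat n - 1) gchoose i) * (-1) ^ (i + 1) =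
        - (y gchoose n) * t i"
      by (simp add: t_def)
  qed simp
  also have "\<dots> = y gchoose n"
    unfolding sum_distrib_left[symmetric] tail by simp
  finally show ?thesis
    using False by (simp add: y_def)
qed

end
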